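(* Let $X_1$ and $X_2$ be real Banach spaces and let $K_1\subset X_1$, $K_2\subset X_2$ be cones with $K_1\neq\{0\}$ and $K_2\neq\{0\}$. Let $r_1,r_2>0$ and let $$T=(T_1,T_2):\overline{K}_{1,r_1}\times \overline{K}_{2,r_2}\longrightarrow K_1\times K_2$$ be a compact map such that $$\inf\{\|T_1(x,y)\| : x\in K_1,\ y\in K_2,\ \|x\|=r_1,\ \|y\|\le r_2\}>0$$ and $$\inf\{\|T_2(x,y)\| : x\in K_1,\ y\in K_2,\ \|x\|\le r_1,\ \|y\|=r_2\}>0.$$ Then there exist $\lambda_0>0$ and $(x_0,y_0)\in \overline{K}_{1,r_1}\times \overline{K}_{2,r_2}$ with $\|x_0\|=r_1$ or $\|y_0\|=r_2$ such that $$x_0=\lambda_0\,T_1(x_0,y_0),\qquad y_0=\lambda_0\,T_2(x_0,y_0).$$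
   Context: A cone $K$ of a normed linear space $(X,\|\cdot\|)$ is a closed set $K\subset X$ with $K+K\subset K$, $\mu K\subset K$ for all $\mu\ge 0$, and $K\cap(-K)=\{0\}$. For $i\in\{1,2\}$, $\overline{K}_{i,r_i}=\{x\in K_i:\|x\|\le r_i\}$. The norms of all spaces are denoted by $\|\cdot\|$, and $X_1\times X_2$ carries the maximum norm. A compact map is a continuous map with relatively compact image. *)

theory Defs
  imports "HOL-Analysis.Analysis"
begin

(* Not the library's predicate "cone", which asks only for closure under
   nonnegative scaling. *)
definition order_cone :: "'a::real_normed_vector set \<Rightarrow> bool" where
  "order_cone K \<longleftrightarrow>
     closed K \<and>
     (\<forall>x\<in>K. \<forall>y\<in>K. x + y \<in> K) \<and>
     (\<forall>\<mu>\<ge>0. \<forall>x\<in>K. \<mu> *\<^sub>R x \<in> K) \<and>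
     K \<inter> uminus ` K = {0}"

definition cone_ball :: "'a::real_normed_vector set \<Rightarrow> real \<Rightarrow> 'a set" where
  "cone_ball K r = {x \<in> K. norm x \<le> r}"

(* On a product type the library norm is the Euclidean combination of the two
   norms, not their maximum.  The two are equivalent, so they give the same
   continuous maps and the same relatively compact sets, which is all that is
   used here.

   The closure is taken in the whole space; for closed B, as in a product of
   cones, this is the closure in B. *)
definition compact_map :: "'a::topological_space set \<Rightarrow> 'b::topological_space set \<Rightarrow> ('a \<Rightarrow> 'b) \<Rightarrow> bool" where
  "compact_map A B f \<longleftrightarrow> f \<in> A \<rightarrow> B \<and> continuous_on A f \<and> compact (closure (f ` A))"

end

theory Submission
  imports Defs
begin

text \<open>
  Let \<open>p (x, y) = max (\<parallel>x\<parallel> / r1) (\<parallel>y\<parallel> / r2)\<close>, so that the domain of \<open>T\<close> is the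
  \<open>p\<close>-unit ball of the cone \<open>K1 \<times> K2\<close>.  Pushing a point \<open>z\<close> of this ball in a fixed direction
  \<open>e \<noteq> 0\<close> of the cone by \<open>1 - p z\<close> never reaches the origin, because the cone is pointed;
  normalising afterwards retracts the ball onto its sphere \<open>p = 1\<close>.  On the sphere \<open>p \<circ> T\<close> is
  bounded away from \<open>0\<close>, so the normalisation of \<open>T \<circ> retraction\<close> is a compact self-map of the
  ball with values in the sphere.  A fixed point, which exists by Schauder's theorem, lies on
  the sphere, is left alone by the retraction and is the required eigenvector.

  The dimension of the simplices occurring in Schauder's theorem varies, so
  Brouwer's theorem is needed for cubes in \<open>nat \<Rightarrow> real\<close>; it follows from Kuhn's lemma.
\<close>

section \<open>Brouwer's theorem for cubes of sequences\<close>

definition seq_cube :: "nat \<Rightarrow> (nat \<Rightarrow> real) set" where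
  "seq_cube n = {t. \<forall>i. 0 \<le> t i \<and> t i \<le> 1 \<and> (n \<le> i \<longrightarrow> t i = 0)}"

text \<open>Tychonoff: the cube is a product of compact intervals, degenerate from index
  \<open>n\<close> on.\<close>

lemma compact_seq_cube: "compact (seq_cube n)"
proof -
  have "seq_cube n = PiE UNIV (\<lambda>i. if i < n then {0..1} else {0})"
  proof (rule set_eqI)
    fix t
    have "t \<in> seq_cube n \<longleftrightarrow> (\<forall>i. t i \<in> (if i < n then {0..1} else {0}))"
      unfolding seq_cube_def mem_Collect_eq by (intro iff_allI) auto
    then show "t \<in> seq_cube n \<longleftrightarrow> t \<in> PiE UNIV (\<lambda>i. if i < n then {0..1} else {0})"
      by (simp only: PiE_iff UNIV_I extensional_UNIV ball_UNIV simp_thms)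
  qed
  moreover have "compactin (product_topology (\<lambda>_. euclidean) UNIV)
      (PiE UNIV (\<lambda>i. if i < n then {0..1::real} else {0}))"
    unfolding compactin_PiE by (auto simp: compactin_euclidean_iff)
  ultimately show ?thesis
    by (simp add: euclidean_product_topology flip: compactin_euclidean_iff)
qed

lemma tendsto_fun_iff:
  fixes f :: "'c \<Rightarrow> 'a \<Rightarrow> 'b::topological_space"
  shows "(f \<longlongrightarrow> l) F \<longleftrightarrow> (\<forall>i. ((\<lambda>c. f c i) \<longlongrightarrow> l i) F)"
  using limitin_componentwise[of "\<lambda>_. euclidean" UNIV f l F]
  by (simp add: euclidean_product_topology)

text \<open>Serves twice: for corners of shrinking grid cells, and for approximate fixed points and
  their images.\<close>

lemma tendsto_subseq_perturb:
  fixes a b :: "nat \<Rightarrow> 'a::real_normed_vector" and s :: "nat \<Rightarrow> nat"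
  assumes "a \<longlonglongrightarrow> l" and "strict_mono s"
    and close: "\<And>k. norm (b k - a k) \<le> 1 / real (Suc (s k))"
  shows "b \<longlonglongrightarrow> l"
proof -
  have "(\<lambda>k. inverse (real (Suc (s k)))) \<longlonglongrightarrow> 0"
    using LIMSEQ_subseq_LIMSEQ[OF LIMSEQ_inverse_real_of_nat assms(2)] by (simp only: o_def)
  then have "(\<lambda>k. b k - a k) \<longlonglongrightarrow> 0"
  proof (rule Lim_null_comparison[rotated])
    show "\<forall>\<^sub>F k in sequentially. norm (b k - a k) \<le> inverse (real (Suc (s k)))"
      using close unfolding inverse_eq_divide by (intro always_eventually allI)
  qed
  from tendsto_add[OF this assms(1)] show ?thesis by simp
qed

text \<open>For each coordinate, Kuhn's lemma finds two corners of one small grid cell at which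
  \<open>h\<close> moves that coordinate in opposite directions, in the weak sense. Along a
  subsequence the cells shrink to a point \<open>t\<close>, where both inequalities survive.\<close>

lemma brouwer_seq_cube:
  assumes cont: "continuous_on (seq_cube n) h" and sub: "h \<in> seq_cube n \<rightarrow> seq_cube n"
  shows "\<exists>t\<in>seq_cube n. h t = t"
proof -
  \<comment> \<open>Grid points of mesh \<open>1 / Suc m\<close>. The zero tail keeps them in the
    cube whatever \<open>x\<close> does from index \<open>n\<close> on.\<close>
  define g where "g m x = (\<lambda>i. if i < n then real (x i) / real (Suc m) else 0)"
    for m and x :: "nat \<Rightarrow> nat"
  \<comment> \<open>Label 0 means that \<open>h\<close> does not decrease coordinate
    \<open>i\<close>. Kuhn's lemma demands label 1 on the whole upper face, hence the exception at
    \<open>Suc m\<close>; it is harmless, since there the coordinate is 1 and \<open>h\<close>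
    cannot exceed it.\<close>
  define lab where "lab m x i =
      (if x i \<noteq> Suc m \<and> g m x i \<le> h (g m x) i then 0 else 1::nat)" for m x i
  have g_in: "g m x \<in> seq_cube n" if "\<forall>i<n. x i \<le> Suc m" for m x
    using that by (auto simp: g_def seq_cube_def divide_simps)
  have h_bd: "0 \<le> h t i" "h t i \<le> 1" "n \<le> i \<Longrightarrow> h t i = 0" if "t \<in> seq_cube n" for t i
    using sub that by (auto simp: seq_cube_def Pi_def)
  have lab01: "lab m x i = 0 \<or> lab m x i = 1" for m x i by (simp add: lab_def)
  have lab0: "g m x i \<le> h (g m x) i" if "lab m x i = 0" for m x i
    using that by (auto simp: lab_def split: if_splits)
  have lab1: "h (g m x) i \<le> g m x i" if "lab m x i \<noteq> 0" "\<forall>j<n. x j \<le> Suc m" "i < n" for m x i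
    using that h_bd(2)[OF g_in[OF that(2)], of i]
    by (auto simp: lab_def g_def split: if_splits)
  define corner where "corner q x \<longleftrightarrow> (\<forall>j<n. q j \<le> x j \<and> x j \<le> q j + 1)"
    for q x :: "nat \<Rightarrow> nat"
  have "\<exists>q. (\<forall>i<n. q i < Suc m) \<and>
      (\<forall>i<n. \<exists>r s. corner q r \<and> corner q s \<and> lab m r i \<noteq> lab m s i)" for m
    unfolding corner_def
  proof (rule kuhn_lemma[of "Suc m" n "lab m"])
    show "\<forall>x. (\<forall>i<n. x i \<le> Suc m) \<longrightarrow> (\<forall>i<n. x i = 0 \<longrightarrow> lab m x i = 0)"
      using h_bd(1)[OF g_in] by (auto simp: lab_def g_def)
    show "\<forall>x. (\<forall>i<n. x i \<le> Suc m) \<longrightarrow> (\<forall>i<n. lab m x i = 0 \<or> lab m x i = 1)"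
      and "\<forall>x. (\<forall>i<n. x i \<le> Suc m) \<longrightarrow> (\<forall>i<n. x i = Suc m \<longrightarrow> lab m x i = 1)"
      by (auto simp: lab_def)
  qed (simp, blast)
  then have "\<exists>q. \<forall>m. (\<forall>i<n. q m i < Suc m) \<and>
      (\<forall>i<n. \<exists>r s. corner (q m) r \<and> corner (q m) s \<and> lab m r i \<noteq> lab m s i)"
    by (intro choice allI)
  then obtain q where q: "\<And>m i. i < n \<Longrightarrow> q m i < Suc m"
    and rs: "\<And>m i. i < n \<Longrightarrow>
      \<exists>r s. corner (q m) r \<and> corner (q m) s \<and> lab m r i \<noteq> lab m s i"
    by blast
  have both: "\<exists>r. corner (q m) r \<and> lab m r i = 0" "\<exists>s. corner (q m) s \<and> lab m s i \<noteq> 0"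
    if "i < n" for m i
    using rs[OF that, of m] lab01 by (metis (no_types, lifting))+
  have q_in: "g m (q m) \<in> seq_cube n" for m
    by (rule g_in) (use q less_imp_le in blast)
  have corner_le: "\<forall>j<n. x j \<le> Suc m" if "corner (q m) x" for m x
    using that q[of _ m] by (fastforce simp: corner_def)
  obtain t \<sigma> where t: "t \<in> seq_cube n" and \<sigma>: "strict_mono (\<sigma> :: nat \<Rightarrow> nat)"
    and lim: "((\<lambda>m. g m (q m)) \<circ> \<sigma>) \<longlonglongrightarrow> t"
    using compact_imp_seq_compact[OF compact_seq_cube] q_in unfolding seq_compact_def by metis
  \<comment> \<open>Any choice of corners, one per cell, has the limit \<open>t\<close>, so this
    applies both to the corners labelled 0 and to those labelled 1.\<close>
  have close: "(\<lambda>k. h (g (\<sigma> k) (x k)) i - g (\<sigma> k) (x k) i) \<longlonglongrightarrow> h t i - t i"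
    if x: "\<And>k. corner (q (\<sigma> k)) (x k)" for x i
  proof -
    have coord: "(\<lambda>k. g (\<sigma> k) (x k) j) \<longlonglongrightarrow> t j" for j
    proof (rule tendsto_subseq_perturb[OF _ \<sigma>])
      show "(\<lambda>k. g (\<sigma> k) (q (\<sigma> k)) j) \<longlonglongrightarrow> t j"
        using lim by (auto simp: o_def tendsto_fun_iff)
      show "norm (g (\<sigma> k) (x k) j - g (\<sigma> k) (q (\<sigma> k)) j) \<le> 1 / real (Suc (\<sigma> k))" for k
      proof (cases "j < n")
        case True
        with x[of k] have "\<bar>real (x k j) - real (q (\<sigma> k) j)\<bar> \<le> 1"
          by (fastforce simp: corner_def)
        then show ?thesis using True
          by (simp add: g_def divide_right_mono flip: diff_divide_distrib)
      qed (simp add: g_def)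
    qed
    then have "(\<lambda>k. g (\<sigma> k) (x k)) \<longlonglongrightarrow> t" by (simp add: tendsto_fun_iff)
    then have "(\<lambda>k. h (g (\<sigma> k) (x k))) \<longlonglongrightarrow> h t"
      by (rule continuous_on_tendsto_compose[OF cont]) (use t g_in corner_le x in auto)
    then show ?thesis
      using coord by (intro tendsto_diff) (auto simp: tendsto_fun_iff)
  qed
  have "h t i = t i" for i
  proof (cases "i < n")
    case True
    obtain r where r: "\<And>m. corner (q m) (r m)" "\<And>m. lab m (r m) i = 0"
      using both(1)[OF True] by metis
    obtain s where s: "\<And>m. corner (q m) (s m)" "\<And>m. lab m (s m) i \<noteq> 0"
      using both(2)[OF True] by metis
    have "0 \<le> h t i - t i"
      by (rule LIMSEQ_le_const[OF close[of "\<lambda>k. r (\<sigma> k)"]])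
        (use r lab0 in auto)
    moreover have "h t i - t i \<le> 0"
      by (rule LIMSEQ_le_const2[OF close[of "\<lambda>k. s (\<sigma> k)"]])
        (use s lab1[OF _ corner_le True] in auto)
    ultimately show ?thesis by simp
  qed (use t h_bd(3)[OF t] in \<open>auto simp: seq_cube_def\<close>)
  with t show ?thesis by auto
qed

section \<open>Schauder's theorem\<close>

text \<open>Schauder projection: a point of \<open>M\<close> is replaced by a convex combination of
  the nearby points of a finite \<open>e\<close>-net. Brouwer's theorem is applied to the weights of
  these combinations.\<close>

lemma schauder_approximate:
  fixes f :: "'a::real_normed_vector \<Rightarrow> 'a"
  assumes S: "convex S" "S \<noteq> {}" and cont: "continuous_on S f"
    and f: "f \<in> S \<rightarrow> M" and M: "compact M" "M \<subseteq> S" and e: "e > 0"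
  shows "\<exists>x\<in>S. norm (x - f x) \<le> e"
proof -
  obtain k where k: "finite k" "k \<subseteq> M" "M \<subseteq> (\<Union>x\<in>k. ball x e)"
    using compactE_image[OF M(1), of M "\<lambda>x. ball x e"] e by (metis UN_I centre_in_ball open_ball subsetI)
  have "M \<noteq> {}" using S(2) f by auto
  with k(3) have "k \<noteq> {}" by auto
  obtain n c where c: "k = c ` {..<n::nat}"
    using k(1) by (metis finite_imp_nat_seg_image_inj_on lessThan_def)
  with \<open>k \<noteq> {}\<close> have n: "n > 0" by auto
  have cM: "c i \<in> M" if "i < n" for i using k(2) c that by auto
  \<comment> \<open>Bumps supported in the \<open>e\<close>-balls of the net; divided by their sum
    they form a partition of unity on \<open>M\<close>.\<close>
  define \<phi> where "\<phi> i y = max 0 (e - dist (c i) y)" for i y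
  define \<Phi> where "\<Phi> y = (\<Sum>i<n. \<phi> i y)" for y
  have \<phi>0: "\<phi> i y \<ge> 0" for i y by (simp add: \<phi>_def)
  have \<Phi>pos: "\<Phi> y > 0" if y: "y \<in> M" for y
  proof -
    obtain i where "i < n" "dist (c i) y < e" using k(3) c y by auto
    then show ?thesis unfolding \<Phi>_def
      by (intro sum_pos2[of _ i]) (auto simp: \<phi>_def)
  qed
  \<comment> \<open>The added deficit makes the weights normalisable on the whole cube, also at 0, and
    vanishes where the coordinates sum to 1, hence at the fixed point.\<close>
  define u where "u t i = t i + max 0 (1 - (\<Sum>j<n. t j))" for t :: "nat \<Rightarrow> real" and i
  define U where "U t = (\<Sum>i<n. u t i)" for t
  define X where "X t = (\<Sum>i<n. (u t i / U t) *\<^sub>R c i)" for t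
  \<comment> \<open>The projection weights of \<open>f (X t)\<close>. At a fixed point,
    \<open>X t\<close> is therefore the Schauder projection of \<open>f (X t)\<close>.\<close>
  define h where "h t i = (if i < n then \<phi> i (f (X t)) / \<Phi> (f (X t)) else 0)" for t i
  have U1: "U t \<ge> 1" for t
  proof -
    let ?m = "max 0 (1 - (\<Sum>j<n. t j))"
    have "U t = (\<Sum>j<n. t j) + real n * ?m"
      by (simp add: U_def u_def sum.distrib)
    moreover have "1 * ?m \<le> real n * ?m"
      using n by (intro mult_right_mono) auto
    moreover have "1 - (\<Sum>j<n. t j) \<le> ?m" by (rule max.cobounded2)
    ultimately show ?thesis unfolding mult_1_left by argo
  qed
  have U0: "U t \<noteq> 0" for t using U1[of t] by linarith
  have XS: "X t \<in> S" if "t \<in> seq_cube n" for t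
    unfolding X_def
  proof (rule convex_sum)
    show "(\<Sum>i<n. u t i / U t) = 1"
      using U0[of t] by (simp add: U_def flip: sum_divide_distrib)
    show "0 \<le> u t i / U t" for i
      using that U1[of t] by (auto simp: u_def seq_cube_def)
  qed (use S cM M in auto)
  have fX: "f (X t) \<in> M" if "t \<in> seq_cube n" for t using XS[OF that] f by auto
  have contX: "continuous_on (seq_cube n) X"
    unfolding X_def U_def u_def
    by (intro continuous_intros continuous_on_product_then_coordinatewise)
      (use U0 in \<open>auto simp: U_def u_def\<close>)
  have contfX: "continuous_on (seq_cube n) (\<lambda>t. f (X t))"
    by (rule continuous_on_compose2[OF cont contX]) (use XS in auto)
  have "continuous_on (seq_cube n) (\<lambda>t. h t i)" for i
  proof (cases "i < n")
    case True
    have "\<Phi> (f (X t)) \<noteq> 0" if "t \<in> seq_cube n" for t using \<Phi>pos[OF fX[OF that]] by simp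
    then show ?thesis
      unfolding h_def \<Phi>_def \<phi>_def using True
      by (auto intro!: continuous_intros contfX)
  qed (simp add: h_def)
  then have "continuous_on (seq_cube n) h" by (rule continuous_on_coordinatewise_then_product)
  moreover have "h \<in> seq_cube n \<rightarrow> seq_cube n"
  proof
    fix t assume t: "t \<in> seq_cube n"
    have "\<phi> i y \<le> \<Phi> y" if "i < n" for i y
      unfolding \<Phi>_def using that \<phi>0 by (intro member_le_sum) auto
    then show "h t \<in> seq_cube n"
      using \<Phi>pos[OF fX[OF t]] \<phi>0 by (auto simp: seq_cube_def h_def)
  qed
  ultimately obtain t where t: "t \<in> seq_cube n" "h t = t" using brouwer_seq_cube by blast
  define y where "y = f (X t)"
  have y: "\<Phi> y > 0" using \<Phi>pos fX[OF t(1)] y_def by simp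
  have ti: "t i = \<phi> i y / \<Phi> y" if "i < n" for i
    using fun_cong[OF t(2), of i] that by (simp add: h_def y_def)
  have t1: "(\<Sum>i<n. t i) = 1"
    using y by (simp add: ti flip: sum_divide_distrib \<Phi>_def)
  then have "X t = (\<Sum>i<n. t i *\<^sub>R c i)"
    by (simp add: X_def U_def u_def)
  moreover have "(\<Sum>i<n. t i *\<^sub>R y) = y"
    using t1 by (simp flip: scaleR_sum_left)
  ultimately have "X t - y = (\<Sum>i<n. t i *\<^sub>R (c i - y))"
    by (simp add: scaleR_diff_right sum_subtractf)
  also have "norm \<dots> \<le> (\<Sum>i<n. t i * e)"
  proof (rule sum_norm_le)
    fix i assume "i \<in> {..<n}"
    then have i: "t i = \<phi> i y / \<Phi> y" using ti by simp
    \<comment> \<open>Net points at distance at least \<open>e\<close> from \<open>y\<close> carry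
      weight 0.\<close>
    show "norm (t i *\<^sub>R (c i - y)) \<le> t i * e"
    proof (cases "dist (c i) y < e")
      case True
      have "0 \<le> t i" using i \<phi>0[of i y] y by simp
      then show ?thesis using True by (simp add: dist_norm mult_left_mono)
    qed (simp add: i \<phi>_def)
  qed
  also have "\<dots> = e" using t1 by (simp flip: sum_distrib_right)
  finally show ?thesis using XS[OF t(1)] y_def by blast
qed

text \<open>The images of approximate fixed points subconverge in \<open>M\<close>; the points
  themselves then have the same limit, which continuity makes a fixed point.\<close>

theorem schauder:
  fixes f :: "'a::real_normed_vector \<Rightarrow> 'a"
  assumes S: "convex S" "S \<noteq> {}" and cont: "continuous_on S f"
    and f: "f \<in> S \<rightarrow> M" and M: "compact M" "M \<subseteq> S"
  shows "\<exists>x\<in>S. f x = x"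
proof -
  have "\<forall>k. \<exists>x\<in>S. norm (x - f x) \<le> 1 / real (Suc k)"
    using schauder_approximate[OF assms] by simp
  then obtain x where x: "\<And>k. x k \<in> S" "\<And>k. norm (x k - f (x k)) \<le> 1 / real (Suc k)"
    by metis
  obtain l \<sigma> where l: "l \<in> M" and \<sigma>: "strict_mono (\<sigma> :: nat \<Rightarrow> nat)"
    and lim: "((\<lambda>k. f (x k)) \<circ> \<sigma>) \<longlonglongrightarrow> l"
  proof (rule seq_compactE[OF compact_imp_seq_compact[OF M(1)]])
    show "\<forall>k. f (x k) \<in> M" using f x(1) by auto
  qed
  have "(\<lambda>k. x (\<sigma> k)) \<longlonglongrightarrow> l"
    by (rule tendsto_subseq_perturb[OF lim \<sigma>]) (use x(2) in simp)
  then have "(\<lambda>k. f (x (\<sigma> k))) \<longlonglongrightarrow> f l"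
    by (rule continuous_on_tendsto_compose[OF cont]) (use l M x in auto)
  with lim have "f l = l" by (auto simp: o_def intro: LIMSEQ_unique)
  with l M show ?thesis by auto
qed

section \<open>Eigenvectors on the boundary of a ball in a product of cones\<close>

lemma convex_cone_ball:
  assumes "order_cone K" shows "convex (cone_ball K r)"
proof -
  have "convex K" using assms by (auto simp: order_cone_def convex_def)
  moreover have "cone_ball K r = K \<inter> cball 0 r" by (auto simp: cone_ball_def)
  ultimately show ?thesis by (simp add: convex_Int)
qed

lemma order_cone_pointed:
  assumes "order_cone K" "x \<in> K" "y \<in> K" "x + y = 0"
  shows "x = 0"
proof -
  have "x = - y" using assms(4) by (simp add: eq_neg_iff_add_eq_0)
  then have "x \<in> K \<inter> uminus ` K" using assms by auto
  then show ?thesis using assms(1) unfolding order_cone_def by blast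
qed

text \<open>Norms are bounded below by 0, so \<open>Inf\<close> is a genuine infimum here.\<close>

lemma Inf_norm_lower:
  fixes f :: "'a \<Rightarrow> 'b \<Rightarrow> 'c::real_normed_vector"
  assumes "P x y"
  shows "Inf {norm (f x y) |x y. P x y} \<le> norm (f x y)"
  by (rule cInf_lower) (use assms in \<open>auto intro: bdd_belowI[of _ 0]\<close>)

theorem theorem2p7:
  fixes K1 :: "'a::banach set" and K2 :: "'b::banach set"
    and T1 :: "'a \<Rightarrow> 'b \<Rightarrow> 'a" and T2 :: "'a \<Rightarrow> 'b \<Rightarrow> 'b"
    and r1 r2 :: real
  assumes "order_cone K1" and "order_cone K2"
    and "K1 \<noteq> {0}" and "K2 \<noteq> {0}"
    and "r1 > 0" and "r2 > 0"
    and "compact_map (cone_ball K1 r1 \<times> cone_ball K2 r2) (K1 \<times> K2)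
           (\<lambda>(x, y). (T1 x y, T2 x y))"
    and "Inf {norm (T1 x y) |x y. x \<in> K1 \<and> y \<in> K2 \<and> norm x = r1 \<and> norm y \<le> r2} > 0"
    and "Inf {norm (T2 x y) |x y. x \<in> K1 \<and> y \<in> K2 \<and> norm x \<le> r1 \<and> norm y = r2} > 0"
  shows "\<exists>l0>0. \<exists>x0\<in>cone_ball K1 r1. \<exists>y0\<in>cone_ball K2 r2.
           (norm x0 = r1 \<or> norm y0 = r2) \<and>
           x0 = l0 *\<^sub>R T1 x0 y0 \<and> y0 = l0 *\<^sub>R T2 x0 y0"
proof -
  define B where "B = cone_ball K1 r1 \<times> cone_ball K2 r2"
  define T where "T = (\<lambda>(x, y). (T1 x y, T2 x y))"
  define p where "p z = max (norm (fst z) / r1) (norm (snd z) / r2)" for z :: "'a \<times> 'b"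
  \<comment> \<open>Radial projection onto the sphere \<open>p = 1\<close>; division by zero gives
    it the value 0 at the origin.\<close>
  define \<nu> where "\<nu> z = (1 / p z) *\<^sub>R z" for z
  have K0: "0 \<in> K1" "0 \<in> K2" using assms(1,2) by (auto simp: order_cone_def)
  have T: "T \<in> B \<rightarrow> K1 \<times> K2" "continuous_on B T" "compact (closure (T ` B))"
    using assms(7) by (auto simp: compact_map_def B_def T_def)
  have p0: "p z \<ge> 0" for z using assms(5,6) by (simp add: p_def le_max_iff_disj)
  have p_eq0: "p z = 0 \<longleftrightarrow> z = 0" for z
    using assms(5,6) by (auto simp: p_def prod_eq_iff max_def split: if_splits)
      (auto simp: divide_le_0_iff)
  have p_scale: "p (a *\<^sub>R z) = a * p z" if "a \<ge> 0" for a z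
    using that by (simp add: p_def max_mult_distrib_left)
  have contp: "continuous_on A p" for A
    unfolding p_def by (intro continuous_intros) (use assms(5,6) in auto)
  have B_iff: "z \<in> B \<longleftrightarrow> z \<in> K1 \<times> K2 \<and> p z \<le> 1" for z
    using assms(5,6) by (cases z) (auto simp: B_def cone_ball_def p_def)
  have K_scale: "a *\<^sub>R z \<in> K1 \<times> K2" if "a \<ge> 0" "z \<in> K1 \<times> K2" for a z
    using that assms(1,2) by (cases z) (auto simp: order_cone_def)
  have K_add: "z + w \<in> K1 \<times> K2" if "z \<in> K1 \<times> K2" "w \<in> K1 \<times> K2" for z w
    using that assms(1,2) by (cases z; cases w) (auto simp: order_cone_def)
  have p\<nu>: "p (\<nu> z) = 1" if "z \<noteq> 0" for z
    using that p0[of z] p_eq0[of z] by (simp add: \<nu>_def p_scale)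
  have \<nu>B: "\<nu> z \<in> B" if "z \<in> K1 \<times> K2" "z \<noteq> 0" for z
    using p\<nu>[OF that(2)] K_scale[OF _ that(1)] p0[of z] unfolding B_iff \<nu>_def by simp
  have cont\<nu>: "continuous_on A \<nu>" if "0 \<notin> A" for A
    unfolding \<nu>_def by (intro continuous_intros contp) (use that p_eq0 in auto)

  obtain e1 where e1: "e1 \<in> K1" "e1 \<noteq> 0" using assms(3) K0 by blast
  \<comment> \<open>The push fades to zero on the sphere, whose points therefore stay fixed.\<close>
  define \<eta> where "\<eta> z = z + (1 - p z) *\<^sub>R (e1, 0::'b)" for z
  have \<eta>K: "\<eta> z \<in> K1 \<times> K2" if "z \<in> B" for z
    unfolding \<eta>_def using that e1 K0 by (intro K_add K_scale) (auto simp: B_iff)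
  have \<eta>0: "\<eta> z \<noteq> 0" if z: "z \<in> B" for z
  proof
    assume 0: "\<eta> z = 0"
    have "fst z + (1 - p z) *\<^sub>R e1 = 0" and snd: "snd z = 0"
      using 0 by (auto simp: \<eta>_def prod_eq_iff)
    moreover have "fst z \<in> K1" "(1 - p z) *\<^sub>R e1 \<in> K1"
      using z e1 assms(1) by (auto simp: B_iff order_cone_def)
    ultimately have "fst z = 0" using order_cone_pointed[OF assms(1)] by blast
    with snd have "z = 0" by (simp add: prod_eq_iff)
    \<comment> \<open>At the origin the push is the full vector \<open>e1\<close>, which is not
      0.\<close>
    with 0 p_eq0[of z] e1 show False by (simp add: \<eta>_def prod_eq_iff)
  qed
  define \<rho> where "\<rho> z = \<nu> (\<eta> z)" for z
  have \<rho>B: "\<rho> z \<in> B" and p\<rho>: "p (\<rho> z) = 1" if "z \<in> B" for z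
    using \<nu>B[OF \<eta>K \<eta>0] p\<nu>[OF \<eta>0] that by (auto simp: \<rho>_def)
  have cont\<rho>: "continuous_on B \<rho>"
    unfolding \<rho>_def
    by (rule continuous_on_compose2[OF cont\<nu>[of "\<eta> ` B"]])
      (use \<eta>0 in \<open>auto simp: \<eta>_def intro!: continuous_intros contp\<close>)

  obtain \<delta> where \<delta>: "\<delta> > 0" "\<And>z. z \<in> B \<Longrightarrow> p z = 1 \<Longrightarrow> \<delta> \<le> p (T z)"
  proof
    let ?I1 = "Inf {norm (T1 x y) |x y. x \<in> K1 \<and> y \<in> K2 \<and> norm x = r1 \<and> norm y \<le> r2}"
    let ?I2 = "Inf {norm (T2 x y) |x y. x \<in> K1 \<and> y \<in> K2 \<and> norm x \<le> r1 \<and> norm y = r2}"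
    \<comment> \<open>The radii enter because \<open>p\<close> divides each component's norm by its
      radius.\<close>
    show "min (?I1 / r1) (?I2 / r2) > 0" using assms(5,6,8,9) by simp
    fix z assume z: "z \<in> B" "p z = 1"
    obtain x y where xy: "z = (x, y)" by (cases z)
    have in_K: "x \<in> K1" "y \<in> K2" "norm x \<le> r1" "norm y \<le> r2"
      using z(1) by (auto simp: B_def cone_ball_def xy)
    have "norm x = r1 \<or> norm y = r2"
      using z(2) assms(5,6) by (auto simp: p_def xy max_def divide_simps split: if_splits)
    then show "min (?I1 / r1) (?I2 / r2) \<le> p (T z)"
    proof
      assume "norm x = r1"
      then have "?I1 \<le> norm (T1 x y)" using in_K by (intro Inf_norm_lower) auto
      then have "?I1 / r1 \<le> norm (T1 x y) / r1" using assms(5) by (simp add: divide_right_mono)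
      then show ?thesis by (auto simp: p_def T_def xy)
    next
      assume "norm y = r2"
      then have "?I2 \<le> norm (T2 x y)" using in_K by (intro Inf_norm_lower) auto
      then have "?I2 / r2 \<le> norm (T2 x y) / r2" using assms(6) by (simp add: divide_right_mono)
      then show ?thesis by (auto simp: p_def T_def xy)
    qed
  qed

  \<comment> \<open>Cutting off a neighbourhood of the origin, where \<nu> is discontinuous, leaves
    a compact set that still contains all values of \<open>T\<close> on the sphere.\<close>
  define C where "C = closure (T ` B) \<inter> {w. \<delta> \<le> p w}"
  have "compact C"
    unfolding C_def using T(3) contp by (intro compact_Int_closed closed_Collect_le) auto
  have "0 \<notin> C" using \<delta>(1) p_eq0[of 0] by (auto simp: C_def)
  have CK: "C \<subseteq> K1 \<times> K2"
  proof -
    have "closed (K1 \<times> K2)" using assms(1,2) by (auto simp: order_cone_def intro: closed_Times)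
    then have "closure (T ` B) \<subseteq> K1 \<times> K2" using T(1) by (intro closure_minimal image_subsetI) blast+
    then show ?thesis by (auto simp: C_def)
  qed
  have TC: "T (\<rho> z) \<in> C" if "z \<in> B" for z
    using \<rho>B[OF that] p\<rho>[OF that] \<delta>(2) closure_subset[of "T ` B"] by (auto simp: C_def)
  have "\<exists>z\<in>B. \<nu> (T (\<rho> z)) = z"
  proof (rule schauder)
    show "convex B" unfolding B_def using assms(1,2) by (intro convex_Times convex_cone_ball)
    show "B \<noteq> {}" using K0 assms(5,6) by (auto simp: B_def cone_ball_def)
    have "continuous_on B (\<lambda>z. T (\<rho> z))"
      by (rule continuous_on_compose2[OF T(2) cont\<rho>]) (use \<rho>B in auto)
    then show "continuous_on B (\<lambda>z. \<nu> (T (\<rho> z)))"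
      by (rule continuous_on_compose2[OF cont\<nu>[OF \<open>0 \<notin> C\<close>]]) (use TC in auto)
    show "(\<lambda>z. \<nu> (T (\<rho> z))) \<in> B \<rightarrow> \<nu> ` C" using TC by auto
    show "compact (\<nu> ` C)"
      using cont\<nu>[OF \<open>0 \<notin> C\<close>] \<open>compact C\<close> by (rule compact_continuous_image)
    show "\<nu> ` C \<subseteq> B" using CK \<open>0 \<notin> C\<close> \<nu>B by blast
  qed
  then obtain z where z: "z \<in> B" "\<nu> (T (\<rho> z)) = z" by blast
  have Tz0: "T (\<rho> z) \<noteq> 0" using TC[OF z(1)] \<open>0 \<notin> C\<close> by metis
  have pz: "p z = 1" using p\<nu>[OF Tz0] z(2) by simp
  then have "\<rho> z = z" by (simp add: \<rho>_def \<eta>_def \<nu>_def flip: zero_prod_def)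
  \<comment> \<open>Once \<rho> fixes \<open>z\<close>, the normalising factor of \<open>T z\<close>
    is the required \<lambda>.\<close>
  with z Tz0 have eq: "z = (1 / p (T z)) *\<^sub>R T z" and pos: "1 / p (T z) > 0"
    using p0[of "T z"] p_eq0[of "T z"] by (auto simp: \<nu>_def)
  obtain x y where xy: "z = (x, y)" by (cases z)
  have "norm x = r1 \<or> norm y = r2"
    using pz assms(5,6) by (auto simp: p_def xy max_def divide_simps split: if_splits)
  moreover have "x \<in> cone_ball K1 r1" "y \<in> cone_ball K2 r2" using z(1) by (auto simp: B_def xy)
  moreover have "x = (1 / p (T z)) *\<^sub>R T1 x y" "y = (1 / p (T z)) *\<^sub>R T2 x y"
    using arg_cong[OF eq, of fst] arg_cong[OF eq, of snd] by (simp_all add: T_def xy)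
  ultimately show ?thesis using pos by blast
qed

end
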